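(* Let $V=\{1,\dots,n\}$, $m\ge1$, and let $f_1,\dots,f_m:2^V\to\mathbb{R}$ be normalized, monotone non-decreasing, submodular functions. Consider the iterates $\pi_0,\pi_1,\dots$ of the algorithm MMin (described in the context), in which the modular problem at each iteration is solved by an algorithm with approximation factor $\alpha\ge1$. Then for each iteration $t\ge1$, $$\max_i f_i(A_i^{\pi_t})\ \le\ \alpha\max_i f_i(A_i^{\pi_{t-1}}).$$
   Context: $f$ is normalized if $f(\emptyset)=0$, monotone non-decreasing if $f(S)\le f(T)$ for $S\subseteq T$, submodular if $f(S)+f(T)\ge f(S\cup T)+f(S\cap T)$. $f(j\mid S)=f(S\cup\{j\})-f(S)$. $\Pi$ is the set of ordered partitions of $V$ into $m$ pairwise disjoint (possibly empty) blocks covering $V$. Modular upper bounds of $f$ tight at $X$: $m^f_{X,1}(Y)=f(X)-\sum_{j\in X\setminus Y}f(j\mid X\setminus j)+\sum_{j\in Y\setminus X}f(j\mid\emptyset)$ and $m^f_{X,2}(Y)=f(X)-\sum_{j\in X\setminus Y}f(j\mid V\setminus j)+\sum_{j\in Y\setminus X}f(j\mid X)$; both satisfy $m^f_X(Y)\ge f(Y)$ for all $Y$ and $m^f_X(X)=f(X)$. An $\alpha$-approximation ($\alpha\ge1$) for the modular version of submodular load balancing returns, for modular functions $m_1,\dots,m_m$, a partition $\pi$ with $\max_i m_i(A_i^\pi)\le\alpha\min_{\pi'\in\Pi}\max_i m_i(A_i^{\pi'})$. MMin iteration: given $\pi_{t-1}$, for each $i$ choose a modular upper bound $m_i$ of $f_i$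 tight at $A_i^{\pi_{t-1}}$ and let $\pi_t$ be the output of the $\alpha$-approximation algorithm applied to $\min_{\pi\in\Pi}\max_i m_i(A_i^\pi)$. *)

theory Defs
  imports Complex_Main "HOL-Library.FuncSet" "HOL-Library.Disjoint_Sets"
begin

text \<open>Set functions on a ground set \<open>V\<close> are total HOL functions; every property below
  constrains them on subsets of \<open>V\<close> only.\<close>

definition normalized :: "('a set \<Rightarrow> real) \<Rightarrow> bool" where
  "normalized f \<longleftrightarrow> f {} = 0"

definition monotone_nondecreasing :: "'a set \<Rightarrow> ('a set \<Rightarrow> real) \<Rightarrow> bool" where
  "monotone_nondecreasing V f \<longleftrightarrow> (\<forall>S T. S \<subseteq> T \<and> T \<subseteq> V \<longrightarrow> f S \<le> f T)"

definition submodular :: "'a set \<Rightarrow> ('a set \<Rightarrow> real) \<Rightarrow> bool" where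
  "submodular V f \<longleftrightarrow>
     (\<forall>S T. S \<subseteq> V \<and> T \<subseteq> V \<longrightarrow> f S + f T \<ge> f (S \<union> T) + f (S \<inter> T))"

text \<open>Modular functions need not be normalized: the upper bounds below have a nonzero constant
  term in general.\<close>

definition modular :: "'a set \<Rightarrow> ('a set \<Rightarrow> real) \<Rightarrow> bool" where
  "modular V f \<longleftrightarrow>
     (\<forall>S T. S \<subseteq> V \<and> T \<subseteq> V \<longrightarrow> f S + f T = f (S \<union> T) + f (S \<inter> T))"

definition marginal :: "('a set \<Rightarrow> real) \<Rightarrow> 'a \<Rightarrow> 'a set \<Rightarrow> real" where
  "marginal f j S = f (S \<union> {j}) - f S"

definition mod_upper1 :: "('a set \<Rightarrow> real) \<Rightarrow> 'a set \<Rightarrow> 'a set \<Rightarrow> real" where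
  "mod_upper1 f X Y =
     f X - (\<Sum>j\<in>X - Y. marginal f j (X - {j})) + (\<Sum>j\<in>Y - X. marginal f j {})"

definition mod_upper2 :: "'a set \<Rightarrow> ('a set \<Rightarrow> real) \<Rightarrow> 'a set \<Rightarrow> 'a set \<Rightarrow> real" where
  "mod_upper2 V f X Y =
     f X - (\<Sum>j\<in>X - Y. marginal f j (V - {j})) + (\<Sum>j\<in>Y - X. marginal f j X)"

definition tight_modular_upper_bound ::
  "'a set \<Rightarrow> ('a set \<Rightarrow> real) \<Rightarrow> 'a set \<Rightarrow> ('a set \<Rightarrow> real) \<Rightarrow> bool" where
  "tight_modular_upper_bound V f X g \<longleftrightarrow>
     modular V g \<and> (\<forall>Y. Y \<subseteq> V \<longrightarrow> f Y \<le> g Y) \<and> g X = f X"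

text \<open>The bounds MMin may choose. For normalized submodular \<open>f\<close> the first two alternatives are
  instances of the third. They are listed separately so that their being upper bounds is not
  a hypothesis on the algorithm but a consequence of submodularity.\<close>

definition mmin_bound ::
  "'a set \<Rightarrow> ('a set \<Rightarrow> real) \<Rightarrow> 'a set \<Rightarrow> ('a set \<Rightarrow> real) \<Rightarrow> bool" where
  "mmin_bound V f X g \<longleftrightarrow>
     (\<forall>Y. Y \<subseteq> V \<longrightarrow> g Y = mod_upper1 f X Y) \<or>
     (\<forall>Y. Y \<subseteq> V \<longrightarrow> g Y = mod_upper2 V f X Y) \<or>
     tight_modular_upper_bound V f X g"

text \<open>Block \<open>i\<close> of \<open>\<pi>\<close> is \<open>\<pi> i\<close>, for \<open>i \<in> {1..m}\<close>; blocks may be empty, so \<open>partition_on\<close> does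
  not apply. Extensionality outside \<open>{1..m}\<close> makes the set of partitions finite for finite
  \<open>V\<close>, as needed for the minimum over it.\<close>

definition ordered_partitions :: "'a set \<Rightarrow> nat \<Rightarrow> (nat \<Rightarrow> 'a set) set" where
  "ordered_partitions V m =
     {\<pi> \<in> {1..m} \<rightarrow>\<^sub>E Pow V. disjoint_family_on \<pi> {1..m} \<and> (\<Union>i\<in>{1..m}. \<pi> i) = V}"

definition max_load :: "nat \<Rightarrow> (nat \<Rightarrow> 'a set \<Rightarrow> real) \<Rightarrow> (nat \<Rightarrow> 'a set) \<Rightarrow> real" where
  "max_load m f \<pi> = (MAX i\<in>{1..m}. f i (\<pi> i))"

text \<open>The guarantee is imposed on the instance at hand rather than on all modular instances:
  for \<open>\<alpha> > 1\<close> it cannot be met on instances whose optimum is negative, so an algorithm meeting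
  it on all modular tuples would not exist.\<close>

definition approx_solution ::
  "'a set \<Rightarrow> nat \<Rightarrow> real \<Rightarrow> (nat \<Rightarrow> 'a set \<Rightarrow> real) \<Rightarrow> (nat \<Rightarrow> 'a set) \<Rightarrow> bool" where
  "approx_solution V m \<alpha> g \<pi> \<longleftrightarrow>
     \<pi> \<in> ordered_partitions V m \<and>
     max_load m g \<pi> \<le> \<alpha> * (MIN \<pi>'\<in>ordered_partitions V m. max_load m g \<pi>')"

definition mmin_step ::
  "'a set \<Rightarrow> nat \<Rightarrow> real \<Rightarrow> (nat \<Rightarrow> 'a set \<Rightarrow> real) \<Rightarrow> (nat \<Rightarrow> 'a set) \<Rightarrow> (nat \<Rightarrow> 'a set) \<Rightarrow> bool" where
  "mmin_step V m \<alpha> f \<pi> \<pi>' \<longleftrightarrow>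
     (\<exists>g. (\<forall>i\<in>{1..m}. mmin_bound V (f i) (\<pi> i) (g i)) \<and> approx_solution V m \<alpha> g \<pi>')"

definition mmin_iterates ::
  "'a set \<Rightarrow> nat \<Rightarrow> real \<Rightarrow> (nat \<Rightarrow> 'a set \<Rightarrow> real) \<Rightarrow> (nat \<Rightarrow> nat \<Rightarrow> 'a set) \<Rightarrow> bool" where
  "mmin_iterates V m \<alpha> f \<pi> \<longleftrightarrow>
     \<pi> 0 \<in> ordered_partitions V m \<and> (\<forall>t\<ge>1. mmin_step V m \<alpha> f (\<pi> (t - 1)) (\<pi> t))"

end

theory Submission
  imports Defs
begin

text \<open>A chosen bound dominates \<open>f\<^sub>i\<close> everywhere and agrees with it on the previous block. The previous
  partition is feasible for the modular problem, so \<open>\<alpha>\<close> times its old value bounds the modular,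
  and hence the true, value of the new partition. That the two explicit bounds do dominate \<open>f\<close>
  follows by telescoping over the elements exchanged between \<open>X\<close> and \<open>Y\<close>: through
  \<open>X \<inter> Y\<close> for the first bound and through \<open>X \<union> Y\<close> for the second.\<close>

text \<open>Submodularity for the pair \<open>A \<union> {j}\<close> and \<open>B\<close>: since
  \<open>j\<close> lies outside \<open>B\<close>, the two sets meet exactly in
  \<open>A\<close>.\<close>

lemma marginal_antimono:
  assumes "submodular V f" "A \<subseteq> B" "B \<subseteq> V" "j \<in> V" "j \<notin> B"
  shows "marginal f j B \<le> marginal f j A"
proof -
  have "A \<union> {j} \<subseteq> V"
    using assms by auto
  then have "f (A \<union> {j}) + f B \<ge> f ((A \<union> {j}) \<union> B) + f ((A \<union> {j}) \<inter> B)"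
    using assms(1,3) by (simp only: submodular_def)
  moreover have "(A \<union> {j}) \<union> B = B \<union> {j}" "(A \<union> {j}) \<inter> B = A"
    using assms by auto
  ultimately show ?thesis
    by (simp add: marginal_def)
qed

text \<open>Adding \<open>D\<close> element by element, each increment is a marginal over a superset
  of \<open>B\<close>, hence at most the marginal over \<open>B\<close>. The explicit bounds use it
  with \<open>B\<close> empty and with \<open>B = A = X\<close>.\<close>

lemma submodular_union_le_sum_marginal:
  assumes "submodular V f" "finite D" "B \<subseteq> A" "A \<subseteq> V" "D \<subseteq> V" "D \<inter> A = {}"
  shows "f (A \<union> D) \<le> f A + (\<Sum>j\<in>D. marginal f j B)"
  using assms(2,5,6)
proof (induction D rule: finite_induct)
  case empty
  then show ?case by simp
next
  case (insert x D)
  have "marginal f x (A \<union> D) \<le> marginal f x B"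
    using insert assms by (intro marginal_antimono[of V]) auto
  then have "f (A \<union> insert x D) \<le> f (A \<union> D) + marginal f x B"
    by (simp add: marginal_def)
  then show ?case
    using insert by auto
qed

lemma submodular_union_ge_sum_marginal:
  assumes "submodular V f" "finite D" "A \<union> D \<subseteq> B" "B \<subseteq> V" "D \<inter> A = {}"
  shows "f A + (\<Sum>j\<in>D. marginal f j (B - {j})) \<le> f (A \<union> D)"
  using assms(2,3,5)
proof (induction D rule: finite_induct)
  case empty
  then show ?case by simp
next
  case (insert x D)
  \<comment> \<open>The dual comparison: \<open>x\<close> is new, so the set built so far still lies
    inside \<open>B - {x}\<close>.\<close>
  have "marginal f x (B - {x}) \<le> marginal f x (A \<union> D)"
    using insert assms by (intro marginal_antimono[of V]) auto
  then have "f (A \<union> D) + marginal f x (B - {x}) \<le> f (A \<union> insert x D)"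
    by (simp add: marginal_def)
  then show ?case
    using insert by auto
qed

lemma mod_upper1_ge:
  assumes "submodular V f" "finite V" "X \<subseteq> V" "Y \<subseteq> V"
  shows "f Y \<le> mod_upper1 f X Y"
proof -
  have fin: "finite X" "finite Y"
    using assms finite_subset by auto
  \<comment> \<open>Both \<open>Y\<close> and \<open>X\<close> are reached from
    \<open>X \<inter> Y\<close>; eliminating \<open>f (X \<inter> Y)\<close> from the two estimates
    gives the bound.\<close>
  have "f (X \<inter> Y \<union> (Y - X)) \<le> f (X \<inter> Y) + (\<Sum>j\<in>Y - X. marginal f j {})"
    using assms fin by (intro submodular_union_le_sum_marginal[of V]) auto
  moreover have "f (X \<inter> Y) + (\<Sum>j\<in>X - Y. marginal f j (X - {j})) \<le> f (X \<inter> Y \<union> (X - Y))"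
    using assms fin by (intro submodular_union_ge_sum_marginal[of V]) auto
  moreover have "X \<inter> Y \<union> (Y - X) = Y" "X \<inter> Y \<union> (X - Y) = X"
    by auto
  ultimately show ?thesis
    by (simp add: mod_upper1_def)
qed

lemma mod_upper2_ge:
  assumes "submodular V f" "finite V" "X \<subseteq> V" "Y \<subseteq> V"
  shows "f Y \<le> mod_upper2 V f X Y"
proof -
  have fin: "finite X" "finite Y"
    using assms finite_subset by auto
  \<comment> \<open>Here \<open>f (X \<union> Y)\<close> is the common value, bounded above starting
    from \<open>X\<close> and below starting from \<open>Y\<close>.\<close>
  have "f (X \<union> (Y - X)) \<le> f X + (\<Sum>j\<in>Y - X. marginal f j X)"
    using assms fin by (intro submodular_union_le_sum_marginal[of V]) auto
  moreover have "f Y + (\<Sum>j\<in>X - Y. marginal f j (V - {j})) \<le> f (Y \<union> (X - Y))"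
    using assms fin by (intro submodular_union_ge_sum_marginal[of V]) auto
  moreover have "X \<union> (Y - X) = X \<union> Y" "Y \<union> (X - Y) = X \<union> Y"
    by auto
  ultimately show ?thesis
    by (simp add: mod_upper2_def)
qed

lemma mmin_bound_ge:
  assumes "mmin_bound V f X g" "submodular V f" "finite V" "X \<subseteq> V" "Y \<subseteq> V"
  shows "f Y \<le> g Y"
  using assms mod_upper1_ge[of V f X Y] mod_upper2_ge[of V f X Y]
  unfolding mmin_bound_def tight_modular_upper_bound_def by auto

text \<open>At \<open>Y = X\<close> both correction sums of an explicit bound range over the empty
  set.\<close>

lemma mmin_bound_tight:
  assumes "mmin_bound V f X g" "X \<subseteq> V"
  shows "g X = f X"
  using assms
  unfolding mmin_bound_def tight_modular_upper_bound_def mod_upper1_def mod_upper2_def by auto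

lemma finite_ordered_partitions:
  assumes "finite V"
  shows "finite (ordered_partitions V m)"
proof (rule finite_subset)
  show "ordered_partitions V m \<subseteq> {1..m} \<rightarrow>\<^sub>E Pow V"
    by (auto simp: ordered_partitions_def)
  show "finite ({1..m} \<rightarrow>\<^sub>E Pow V)"
    using assms by (intro finite_PiE) auto
qed

lemma ordered_partitions_block_subset:
  assumes "\<pi> \<in> ordered_partitions V m" "i \<in> {1..m}"
  shows "\<pi> i \<subseteq> V"
  using assms by (auto simp: ordered_partitions_def)

lemma max_load_mono:
  assumes "m \<ge> 1" "\<And>i. i \<in> {1..m} \<Longrightarrow> f i (\<pi> i) \<le> g i (\<pi> i)"
  shows "max_load m f \<pi> \<le> max_load m g \<pi>"
  unfolding max_load_def
\<comment> \<open>\<open>m \<ge> 1\<close> makes the index set nonempty, so \<open>Max\<close> is a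
  genuine maximum.\<close>
proof (rule Max.boundedI)
  fix x assume "x \<in> (\<lambda>i. f i (\<pi> i)) ` {1..m}"
  then obtain i where i: "i \<in> {1..m}" "x = f i (\<pi> i)"
    by blast
  have "g i (\<pi> i) \<le> (MAX i\<in>{1..m}. g i (\<pi> i))"
    using i by (intro Max_ge) auto
  with assms(2)[OF i(1)] show "x \<le> (MAX i\<in>{1..m}. g i (\<pi> i))"
    unfolding i(2) by (rule order_trans)
qed (use assms in auto)

lemma mmin_step_max_load:
  assumes "finite V" "m \<ge> 1" "\<alpha> \<ge> 0"
    and submodular: "\<And>i. i \<in> {1..m} \<Longrightarrow> submodular V (f i)"
    and \<pi>: "\<pi> \<in> ordered_partitions V m"
    and step: "mmin_step V m \<alpha> f \<pi> \<pi>'"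
  shows "max_load m f \<pi>' \<le> \<alpha> * max_load m f \<pi>"
proof -
  obtain g where g: "\<And>i. i \<in> {1..m} \<Longrightarrow> mmin_bound V (f i) (\<pi> i) (g i)"
    and approx: "approx_solution V m \<alpha> g \<pi>'"
    using step unfolding mmin_step_def by blast
  have \<pi>': "\<pi>' \<in> ordered_partitions V m"
    using approx unfolding approx_solution_def by blast
  have "max_load m f \<pi>' \<le> max_load m g \<pi>'"
  proof (rule max_load_mono[OF assms(2)])
    fix i assume i: "i \<in> {1..m}"
    show "f i (\<pi>' i) \<le> g i (\<pi>' i)"
      by (rule mmin_bound_ge[OF g[OF i] submodular[OF i] assms(1)
            ordered_partitions_block_subset[OF \<pi> i] ordered_partitions_block_subset[OF \<pi>' i]])
  qed
  also have "\<dots> \<le> \<alpha> * (MIN \<sigma>\<in>ordered_partitions V m. max_load m g \<sigma>)"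
    using approx unfolding approx_solution_def by blast
  \<comment> \<open>\<open>\<pi>\<close> itself competes in the minimum, which is over a finite set;
    multiplying by \<open>\<alpha>\<close> keeps the order as
    \<open>\<alpha> \<ge> 0\<close>.\<close>
  also have "\<dots> \<le> \<alpha> * max_load m g \<pi>"
    using \<pi> finite_ordered_partitions[OF assms(1)] assms(3)
    by (intro mult_left_mono Min_le) auto
  also have "max_load m g \<pi> = max_load m f \<pi>"
  proof -
    have "g i (\<pi> i) = f i (\<pi> i)" if "i \<in> {1..m}" for i
      using mmin_bound_tight[OF g[OF that]] ordered_partitions_block_subset[OF \<pi> that] by simp
    then show ?thesis
      unfolding max_load_def by simp
  qed
  finally show ?thesis .
qed

text \<open>No induction is required: the start is feasible by assumption, and every later iterate
  is an approximate solution, which is feasible by definition.\<close>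

lemma mmin_iterates_ordered_partitions:
  assumes "mmin_iterates V m \<alpha> f \<pi>"
  shows "\<pi> t \<in> ordered_partitions V m"
proof (cases t)
  case 0
  then show ?thesis
    using assms unfolding mmin_iterates_def by simp
next
  case (Suc s)
  then have "t \<ge> 1"
    by simp
  then have "mmin_step V m \<alpha> f (\<pi> (t - 1)) (\<pi> t)"
    using assms unfolding mmin_iterates_def by blast
  then show ?thesis
    unfolding mmin_step_def approx_solution_def by blast
qed

theorem theorem9:
  fixes n m :: nat and V :: "nat set" and f :: "nat \<Rightarrow> nat set \<Rightarrow> real"
    and \<alpha> :: real and \<pi> :: "nat \<Rightarrow> nat \<Rightarrow> nat set"
  assumes "V = {1..n}" and "m \<ge> 1"
    and "\<And>i. i \<in> {1..m} \<Longrightarrow> normalized (f i)"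
    and "\<And>i. i \<in> {1..m} \<Longrightarrow> monotone_nondecreasing V (f i)"
    and "\<And>i. i \<in> {1..m} \<Longrightarrow> submodular V (f i)"
    and "\<alpha> \<ge> 1"
    and "mmin_iterates V m \<alpha> f \<pi>"
  shows "\<forall>t\<ge>1. (MAX i\<in>{1..m}. f i (\<pi> t i)) \<le> \<alpha> * (MAX i\<in>{1..m}. f i (\<pi> (t - 1) i))"
proof (intro allI impI)
  fix t :: nat
  assume "t \<ge> 1"
  then have "mmin_step V m \<alpha> f (\<pi> (t - 1)) (\<pi> t)"
    using assms(7) unfolding mmin_iterates_def by blast
  then have "max_load m f (\<pi> t) \<le> \<alpha> * max_load m f (\<pi> (t - 1))"
    using assms(1,2,5,6) mmin_iterates_ordered_partitions[OF assms(7)]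
    by (intro mmin_step_max_load[of V]) auto
  then show "(MAX i\<in>{1..m}. f i (\<pi> t i)) \<le> \<alpha> * (MAX i\<in>{1..m}. f i (\<pi> (t - 1) i))"
    unfolding max_load_def .
qed

end
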